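(* Let $\alpha\in\mathbb{R}$, $\alpha\neq0$, and let $\Sigma\subset\mathbb{R}^3$ be a $K^\alpha$-translator with speed $\vec{v}$. If $\Sigma$ is a helicoidal surface, then the axis of $\Sigma$ is parallel to the speed vector $\vec{v}$.
   Context: Let $\alpha\in\mathbb{R}$, $\alpha\ne 0$, and let $\vec{v}\in\mathbb{R}^3$ be a unit vector. A smooth surface $\Sigma$ in Euclidean space $\mathbb{R}^3$ with unit normal $N$ and Gauss curvature $K$ is called a $K^\alpha$-translator with speed $\vec{v}$ if $K^\alpha=\langle N,\vec{v}\rangle$ on $\Sigma$. The surface is not required to have $K>0$; it is implicitly assumed that $K^\alpha$ makes sense (for example, $K$ may be negative if $\alpha\in\mathbb{Z}$). Planes and surfaces of constant Gauss curvature are discarded throughout. A helicoidal surface is a surface invariant under a uniparametric group of helicoidal motions with a given axis and pitch $h\neq0$; when the axis is the $z$-axis, it is parametrized by $X(r,\theta)=(r\cos\theta,r\sin\theta,f(r)+h\theta)$, $r\in I$, $\theta\in\mathbb{R}$, where $I\subset(0,\infty)$ is an interval and $f\colon I\to\mathbb{R}$ is a smooth function. *)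

theory Defs
  imports "HOL-Analysis.Analysis"
begin

section \<open>Smooth maps\<close>

primrec times_differentiable_on ::
  "nat \<Rightarrow> 'a::real_normed_vector set \<Rightarrow> ('a \<Rightarrow> 'b::real_normed_vector) \<Rightarrow> bool"
where
  "times_differentiable_on 0 S f \<longleftrightarrow> continuous_on S f"
| "times_differentiable_on (Suc n) S f \<longleftrightarrow>
     (\<forall>x\<in>S. f differentiable (at x)) \<and>
     (\<forall>w. times_differentiable_on n S (\<lambda>x. frechet_derivative f (at x) w))"

text \<open>Intended for open \<open>S\<close> only, since derivatives are not taken within \<open>S\<close>.\<close>

definition smooth_on ::
  "'a::real_normed_vector set \<Rightarrow> ('a \<Rightarrow> 'b::real_normed_vector) \<Rightarrow> bool"
where
  "smooth_on S f \<longleftrightarrow> (\<forall>n. times_differentiable_on n S f)"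


section \<open>Regular surfaces and their Gauss curvature\<close>

definition local_parametrization ::
  "(real^3) set \<Rightarrow> (real^2) set \<Rightarrow> (real^2 \<Rightarrow> real^3) \<Rightarrow> bool"
where
  "local_parametrization \<Sigma> U X \<longleftrightarrow>
     open U \<and> smooth_on U X \<and>
     openin (top_of_set \<Sigma>) (X ` U) \<and> (\<exists>Y. homeomorphism U (X ` U) X Y) \<and>
     (\<forall>q\<in>U. inj (frechet_derivative X (at q)))"

definition regular_surface :: "(real^3) set \<Rightarrow> bool" where
  "regular_surface \<Sigma> \<longleftrightarrow> (\<forall>p\<in>\<Sigma>. \<exists>U X. local_parametrization \<Sigma> U X \<and> p \<in> X ` U)"

definition tangent_space :: "(real^3) set \<Rightarrow> real^3 \<Rightarrow> (real^3) set" where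
  "tangent_space \<Sigma> p =
     {w. \<exists>U X q. local_parametrization \<Sigma> U X \<and> q \<in> U \<and> X q = p \<and>
           w \<in> range (frechet_derivative X (at q))}"

text \<open>Continuity of \<open>N\<close> selects one of the two orientations locally; a continuous unit normal
  field on a smooth surface is automatically smooth.\<close>

definition unit_normal_field :: "(real^3) set \<Rightarrow> (real^3 \<Rightarrow> real^3) \<Rightarrow> bool" where
  "unit_normal_field \<Sigma> N \<longleftrightarrow>
     continuous_on \<Sigma> N \<and>
     (\<forall>p\<in>\<Sigma>. norm (N p) = 1 \<and> (\<forall>w \<in> tangent_space \<Sigma> p. N p \<bullet> w = 0))"

definition pd :: "2 \<Rightarrow> (real^2 \<Rightarrow> real^3) \<Rightarrow> real^2 \<Rightarrow> real^3" where
  "pd i X q = frechet_derivative X (at q) (axis i 1)"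

text \<open>The quotient of the determinants of the second and the first fundamental form.\<close>

definition parametric_gauss_curvature :: "(real^2 \<Rightarrow> real^3) \<Rightarrow> real^2 \<Rightarrow> real" where
  "parametric_gauss_curvature X q =
     (let n = sgn (cross3 (pd 1 X q) (pd 2 X q));
          E = pd 1 X q \<bullet> pd 1 X q; F = pd 1 X q \<bullet> pd 2 X q; G = pd 2 X q \<bullet> pd 2 X q;
          e = pd 1 (pd 1 X) q \<bullet> n; f = pd 1 (pd 2 X) q \<bullet> n; g = pd 2 (pd 2 X) q \<bullet> n
      in (e * g - f\<^sup>2) / (E * G - F\<^sup>2))"

text \<open>On a regular surface the value does not depend on the local parametrization, so the
  description below has exactly one solution for \<open>p \<in> \<Sigma>\<close>.\<close>

definition gauss_curvature :: "(real^3) set \<Rightarrow> real^3 \<Rightarrow> real" where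
  "gauss_curvature \<Sigma> p =
     (THE k. \<forall>U X q. local_parametrization \<Sigma> U X \<and> q \<in> U \<and> X q = p \<longrightarrow>
               k = parametric_gauss_curvature X q)"


section \<open>Real powers with possibly negative base\<close>

text \<open>For a negative base the exponent has to be a fraction with odd denominator (in
  particular, any integer is allowed); the power is then the corresponding power of an odd
  root, see \<open>real_power_fraction\<close>. For base \<open>0\<close> the exponent has to be positive.\<close>

definition real_power_defined :: "real \<Rightarrow> real \<Rightarrow> bool" where
  "real_power_defined x a \<longleftrightarrow>
     0 < x \<or> x = 0 \<and> 0 < a \<or>
     x < 0 \<and> (\<exists>(m::int) (n::nat). odd n \<and> a = of_int m / of_nat n)"

definition real_power :: "real \<Rightarrow> real \<Rightarrow> real" where
  "real_power x a =
     (if 0 \<le> x then x powr a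
      else if \<exists>(m::int) (n::nat). even m \<and> odd n \<and> a = of_int m / of_nat n then \<bar>x\<bar> powr a
      else - (\<bar>x\<bar> powr a))"

lemma real_power_fraction:
  fixes m :: int and n :: nat
  assumes "odd n" "x \<noteq> 0"
  shows "real_power x (of_int m / of_nat n) = root n x powi m"
proof -
  have n: "n > 0" using assms(1) by (simp add: odd_pos)
  have pos: "y powr (of_int m / of_nat n) = root n y powi m" if "y > 0" for y :: real
  proof -
    have "root n y powi m = (y powr (1 / of_nat n)) powr of_int m"
      using that n by (simp add: root_powr_inverse powr_real_of_int')
    then show ?thesis by (simp add: powr_powr)
  qed
  show ?thesis
  proof (cases "x > 0")
    case True
    then show ?thesis by (simp add: real_power_def pos)
  next
    case False
    with assms have x: "x < 0" by simp
    have r: "root n x powi m = (if even m then 1 else -1) * (\<bar>x\<bar> powr (of_int m / of_nat n))"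
    proof -
      have "root n x = - root n \<bar>x\<bar>" using x by (simp add: real_root_minus)
      then show ?thesis using pos[of "\<bar>x\<bar>"] x by (simp add: power_int_minus_left)
    qed
    have "even m" if "even k" "odd l" "of_int m / of_nat n = (of_int k / of_nat l :: real)"
      for k :: int and l :: nat
    proof -
      have "l > 0" using that(2) by (simp add: odd_pos)
      then have "of_int (m * int l) = (of_int (k * int n) :: real)"
        using that(3) n by (simp add: field_simps)
      then have "m * int l = k * int n" using of_int_eq_iff by blast
      then have "even (m * int l)" using that(1) by simp
      then show ?thesis using that(2) by simp
    qed
    then show ?thesis using r x assms(1) by (auto simp: real_power_def)
  qed
qed


section \<open>Translators\<close>

definition K_translator ::
  "real \<Rightarrow> real^3 \<Rightarrow> (real^3) set \<Rightarrow> (real^3 \<Rightarrow> real^3) \<Rightarrow> bool"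
where
  "K_translator \<alpha> v \<Sigma> N \<longleftrightarrow>
     regular_surface \<Sigma> \<and> unit_normal_field \<Sigma> N \<and>
     (\<forall>p\<in>\<Sigma>. real_power_defined (gauss_curvature \<Sigma> p) \<alpha> \<and>
            real_power (gauss_curvature \<Sigma> p) \<alpha> = N p \<bullet> v)"


section \<open>Helicoidal surfaces\<close>

text \<open>Rotation by the angle \<open>t\<close> about the oriented line through the origin with unit direction
  \<open>u\<close> (Rodrigues' formula).\<close>

definition rotation_about :: "real^3 \<Rightarrow> real \<Rightarrow> real^3 \<Rightarrow> real^3" where
  "rotation_about u t x =
     cos t *\<^sub>R x + sin t *\<^sub>R cross3 u x + ((1 - cos t) * (u \<bullet> x)) *\<^sub>R u"

text \<open>The axis is the line through \<open>c\<close> with unit direction \<open>u\<close>, and \<open>h\<close> is the pitch.\<close>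

definition helicoidal_motion :: "real^3 \<Rightarrow> real^3 \<Rightarrow> real \<Rightarrow> real \<Rightarrow> real^3 \<Rightarrow> real^3" where
  "helicoidal_motion c u h t x = c + rotation_about u t (x - c) + (h * t) *\<^sub>R u"

lemma helicoidal_motion_z_axis:
  "helicoidal_motion 0 (axis 3 1) h t (vector [x, y, z]) =
     vector [x * cos t - y * sin t, x * sin t + y * cos t, z + h * t]"
  by (simp add: vec_eq_iff forall_3 helicoidal_motion_def rotation_about_def cross3_def
      inner_vec_def sum_3 axis_def algebra_simps)

definition helicoidal_surface ::
  "real^3 \<Rightarrow> real^3 \<Rightarrow> real \<Rightarrow> (real^3) set \<Rightarrow> bool"
where
  "helicoidal_surface c u h \<Sigma> \<longleftrightarrow>
     norm u = 1 \<and> h \<noteq> 0 \<and> regular_surface \<Sigma> \<and>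
     (\<forall>t. helicoidal_motion c u h t ` \<Sigma> = \<Sigma>)"

end

theory Submission
  imports Defs
begin

text \<open>
  Let \<open>g\<^sub>t\<close> be the helicoidal motions that preserve \<open>\<Sigma>\<close>, with rotational parts \<open>R\<^sub>t\<close>. Each
  \<open>g\<^sub>t\<close> is an isometry of space, so \<open>K\<close> takes the same value at \<open>p\<close> and at \<open>g\<^sub>t p\<close>
  (\<open>gauss_curvature_rigid_motion\<close>), while the unit normal is carried along up to sign:
  \<open>N (g\<^sub>t p) = \<plusminus> R\<^sub>t (N p)\<close> (\<open>unit_normal_field_rigid_motion\<close>). The translator equation therefore
  makes \<open>(R\<^sub>t (N p) \<bullet> v)\<^sup>2\<close> independent of \<open>t\<close>.

  Decompose along the axis direction \<open>u\<close>: as \<open>t\<close> varies, the component of \<open>R\<^sub>t (N p)\<close> orthogonal to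
  \<open>u\<close> turns through all directions of the plane orthogonal to \<open>u\<close>. If \<open>v\<close> is not parallel to \<open>u\<close>,
  its own component in that plane is nonzero, and the product with \<open>v\<close> can have constant
  square only if \<open>N p\<close> has no component in that plane, that is, \<open>N p = \<plusminus> u\<close>
  (\<open>normal_parallel_axis_if_constant_rotated_inner\<close>).

  Then every tangent plane is orthogonal to \<open>u\<close>, so the height \<open>x \<mapsto> u \<bullet> x\<close> is locally
  constant on \<open>\<Sigma>\<close>. But along the orbit of a point the height is \<open>u \<bullet> p + h * t\<close> with
  \<open>h \<noteq> 0\<close>: a contradiction as soon as \<open>\<Sigma>\<close> has a point
  (\<open>helicoidal_surface_normal_not_parallel_axis\<close>).
\<close>


section \<open>Smooth maps under affine maps\<close>

text \<open>The operator \<open>frechet_derivative\<close> is a choice among all derivatives; agreement on a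
  neighbourhood makes the two sets of candidates equal, so the choices agree even where neither
  function is differentiable.\<close>

lemma frechet_derivative_cong_open:
  assumes "open S" "x \<in> S" "\<And>y. y \<in> S \<Longrightarrow> f y = g y"
  shows "frechet_derivative f (at x) = frechet_derivative g (at x)"
proof -
  have "(f has_derivative D) (at x) \<longleftrightarrow> (g has_derivative D) (at x)" for D
    using has_derivative_transform_within_open[of _ D x UNIV S] assms by metis
  then show ?thesis by (simp add: frechet_derivative_def)
qed

lemma times_differentiable_on_cong:
  assumes "open S" "\<And>y. y \<in> S \<Longrightarrow> f y = g y" "times_differentiable_on n S f"
  shows "times_differentiable_on n S g"
  using assms(2,3)
proof (induction n arbitrary: f g)
  case 0
  then show ?case using continuous_on_eq by (auto simp: Ball_def)
next
  case (Suc n)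
  have "g differentiable (at x)" if "x \<in> S" for x
    using Suc.prems that assms(1) has_derivative_transform_within_open[of f _ x UNIV S g]
    unfolding differentiable_def times_differentiable_on.simps by blast
  moreover have "times_differentiable_on n S (\<lambda>x. frechet_derivative g (at x) w)" for w
  proof (rule Suc.IH)
    show "times_differentiable_on n S (\<lambda>x. frechet_derivative f (at x) w)"
      using Suc.prems(2) by simp
    show "frechet_derivative f (at y) w = frechet_derivative g (at y) w" if "y \<in> S" for y
      using frechet_derivative_cong_open[OF assms(1) that Suc.prems(1)] by simp
  qed
  ultimately show ?case by simp
qed

lemma has_derivative_affine_comp:
  assumes "bounded_linear L" "f differentiable (at x)"
  shows "((\<lambda>x. L (f x) + b) has_derivative (\<lambda>w. L (frechet_derivative f (at x) w))) (at x)"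
proof -
  have "(f has_derivative frechet_derivative f (at x)) (at x)"
    using assms(2) frechet_derivative_works by blast
  from bounded_linear.has_derivative[OF assms(1) this]
  show ?thesis by (rule has_derivative_add_const)
qed

lemma frechet_derivative_affine_comp:
  assumes "bounded_linear L" "f differentiable (at x)"
  shows "frechet_derivative (\<lambda>x. L (f x) + b) (at x) = (\<lambda>w. L (frechet_derivative f (at x) w))"
  using has_derivative_affine_comp[OF assms] by (rule frechet_derivative_at[symmetric])

text \<open>An affine map passes through the derivative by losing its constant part, which is why the
  induction has to let \<open>b\<close> vary. The resulting formula for the derivative is valid only on \<open>S\<close>.\<close>

lemma times_differentiable_on_affine_comp:
  assumes "open S" "bounded_linear L" "times_differentiable_on n S f"
  shows "times_differentiable_on n S (\<lambda>x. L (f x) + b)"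
  using assms(3)
proof (induction n arbitrary: f b)
  case 0
  then show ?case
    by (simp add: continuous_on_add bounded_linear.continuous_on[OF assms(2)])
next
  case (Suc n)
  have "(\<lambda>x. L (f x) + b) differentiable (at x)" if "x \<in> S" for x
    using has_derivative_affine_comp[OF assms(2), of f x b] Suc.prems that
    by (meson differentiable_def times_differentiable_on.simps(2))
  moreover have "times_differentiable_on n S (\<lambda>x. frechet_derivative (\<lambda>x. L (f x) + b) (at x) w)" for w
  proof (rule times_differentiable_on_cong[OF assms(1)])
    show "times_differentiable_on n S (\<lambda>x. L (frechet_derivative f (at x) w) + 0)"
      using Suc.prems by (intro Suc.IH) simp
    show "L (frechet_derivative f (at y) w) + 0
          = frechet_derivative (\<lambda>x. L (f x) + b) (at y) w" if "y \<in> S" for y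
      using Suc.prems that by (simp add: frechet_derivative_affine_comp[OF assms(2)])
  qed
  ultimately show ?case by simp
qed

lemma smooth_on_affine_comp:
  "open S \<Longrightarrow> bounded_linear L \<Longrightarrow> smooth_on S f \<Longrightarrow> smooth_on S (\<lambda>x. L (f x) + b)"
  by (simp add: smooth_on_def times_differentiable_on_affine_comp)

lemma smooth_on_imp_differentiable:
  assumes "smooth_on S f" "x \<in> S"
  shows "f differentiable (at x)" "(\<lambda>y. frechet_derivative f (at y) w) differentiable (at x)"
proof -
  have "times_differentiable_on (Suc (Suc 0)) S f"
    using assms(1) unfolding smooth_on_def by blast
  with assms(2)
  show "f differentiable (at x)" "(\<lambda>y. frechet_derivative f (at y) w) differentiable (at x)"
    by simp_all
qed


section \<open>Invariance of the Gauss curvature under rigid motions\<close>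

lemma orthogonal_transformation_imp_bounded_linear:
  fixes L :: "'a::euclidean_space \<Rightarrow> 'a"
  assumes "orthogonal_transformation L"
  shows "bounded_linear L"
  using assms by (simp add: orthogonal_transformation linear_conv_bounded_linear)

text \<open>The sign \<open>d\<close> is the determinant. Only its square enters what follows, since the Gauss curvature is
  quadratic in the normal and a normal line has no preferred direction.\<close>

lemma cross_orthogonal_transformation_sign:
  fixes L :: "real^3 \<Rightarrow> real^3"
  assumes "orthogonal_transformation L"
  obtains d :: real where "d\<^sup>2 = 1" "\<And>x y. cross3 (L x) (L y) = d *\<^sub>R L (cross3 x y)"
proof
  show "cross3 (L x) (L y) = det (matrix L) *\<^sub>R L (cross3 x y)" for x y
    using assms by (rule cross_orthogonal_transformation)
  show "(det (matrix L))\<^sup>2 = 1"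
    using assms det_orthogonal_matrix orthogonal_transformation_matrix by fastforce
qed

lemma pd_affine_comp:
  assumes "orthogonal_transformation L" "X differentiable (at q)"
  shows "pd i (\<lambda>q. L (X q) + b) q = L (pd i X q)"
  using frechet_derivative_affine_comp[OF orthogonal_transformation_imp_bounded_linear] assms
  unfolding pd_def by metis

lemma pd_pd_affine_comp:
  assumes "orthogonal_transformation L" "open U" "smooth_on U X" "q \<in> U"
  shows "pd i (pd j (\<lambda>q. L (X q) + b)) q = L (pd i (pd j X) q)"
proof -
  have "pd i (pd j (\<lambda>q. L (X q) + b)) q = pd i (\<lambda>q. L (pd j X q) + 0) q"
    unfolding pd_def[of i]
    using frechet_derivative_cong_open[OF assms(2,4),
        of "pd j (\<lambda>q. L (X q) + b)" "\<lambda>q. L (pd j X q) + 0"]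
      pd_affine_comp[OF assms(1) smooth_on_imp_differentiable(1)[OF assms(3)]]
    by simp
  also have "\<dots> = L (pd i (pd j X) q)"
    using smooth_on_imp_differentiable(2)[OF assms(3,4)]
    by (intro pd_affine_comp[OF assms(1)]) (simp add: pd_def[abs_def])
  finally show ?thesis .
qed

text \<open>All partial derivatives are transported by \<open>L\<close>, which preserves inner products; the normal is
  transported up to the sign \<open>d\<close>, and \<open>d\<close> enters \<open>e * g - f\<^sup>2\<close> only as \<open>d\<^sup>2 = 1\<close>.\<close>

lemma parametric_gauss_curvature_rigid_motion:
  assumes L: "orthogonal_transformation L" and "open U" "smooth_on U X" "q \<in> U"
  shows "parametric_gauss_curvature (\<lambda>q. L (X q) + b) q = parametric_gauss_curvature X q"
proof -
  obtain d where d: "d\<^sup>2 = 1" "\<And>x y. cross3 (L x) (L y) = d *\<^sub>R L (cross3 x y)"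
    using cross_orthogonal_transformation_sign[OF L] by blast
  have inner: "L x \<bullet> L y = x \<bullet> y" for x y
    using L by (simp add: orthogonal_transformation_def)
  have "\<bar>d\<bar> = 1" using d(1) by (simp add: abs_square_eq_1)
  moreover have "linear L" "norm (L x) = norm x" for x
    using L by (simp_all add: orthogonal_transformation)
  ultimately have n: "sgn (d *\<^sub>R L x) = d *\<^sub>R L (sgn x)" for x
    by (simp add: sgn_div_norm linear_cmul)
  have det: "d * x * (d * y) - (d * z)\<^sup>2 = x * y - z\<^sup>2" for x y z
  proof -
    have "d * x * (d * y) - (d * z)\<^sup>2 = d\<^sup>2 * (x * y - z\<^sup>2)"
      by (simp add: power2_eq_square algebra_simps)
    then show ?thesis by (simp add: d(1))
  qed
  show ?thesis
    unfolding parametric_gauss_curvature_def Let_def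
      pd_affine_comp[OF L smooth_on_imp_differentiable(1)[OF assms(3,4)]]
      pd_pd_affine_comp[OF assms]
    by (simp add: d(2) n inner det)
qed

lemma homeomorphism_rigid_motion:
  assumes L: "orthogonal_transformation (L :: 'a::euclidean_space \<Rightarrow> 'a)"
  shows "homeomorphism S ((\<lambda>x. L x + b) ` S) (\<lambda>x. L x + b) (\<lambda>y. inv L (y - b))"
proof -
  have bl: "bounded_linear L" "bounded_linear (inv L)"
    using L orthogonal_transformation_inv
    by (blast intro: orthogonal_transformation_imp_bounded_linear)+
  have "inv L (L x) = x" for x
    using L by (simp add: orthogonal_transformation_inj)
  then show ?thesis
    by (auto simp: homeomorphism_def image_image
        intro!: continuous_intros bounded_linear.continuous_on[OF bl(1)]
          bounded_linear.continuous_on[OF bl(2)])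
qed

lemma local_parametrization_rigid_motion:
  assumes L: "orthogonal_transformation L" and P: "local_parametrization \<Sigma> U X"
  shows "local_parametrization ((\<lambda>x. L x + b) ` \<Sigma>) U (\<lambda>q. L (X q) + b)"
proof -
  let ?g = "\<lambda>x. L x + b"
  note hom = homeomorphism_rigid_motion[OF L, of _ b]
  have bl: "bounded_linear L" using L by (rule orthogonal_transformation_imp_bounded_linear)
  from P obtain Y where U: "open U" "smooth_on U X" "openin (top_of_set \<Sigma>) (X ` U)"
      "homeomorphism U (X ` U) X Y" and inj: "\<And>q. q \<in> U \<Longrightarrow> inj (frechet_derivative X (at q))"
    by (auto simp: local_parametrization_def)
  have im: "(\<lambda>q. L (X q) + b) ` U = ?g ` (X ` U)" by auto
  have "openin (top_of_set (?g ` \<Sigma>)) (?g ` (X ` U))"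
    using homeomorphism_imp_open_map[OF hom U(3)] .
  moreover have "\<exists>Y. homeomorphism U (?g ` (X ` U)) (\<lambda>q. L (X q) + b) Y"
    using homeomorphism_compose[OF U(4) hom] by (auto simp: o_def)
  moreover have "inj (frechet_derivative (\<lambda>q. L (X q) + b) (at q))" if "q \<in> U" for q
    using inj[OF that] orthogonal_transformation_inj[OF L]
      frechet_derivative_affine_comp[OF bl smooth_on_imp_differentiable(1)[OF U(2) that]]
    by (simp add: inj_def)
  ultimately show ?thesis
    using U smooth_on_affine_comp[OF _ bl] by (simp add: local_parametrization_def im)
qed

text \<open>Composition with the motion is a bijection between the local parametrizations of a surface and
  those of its image, and it preserves the parametric curvature. Hence the two definite
  descriptions have equivalent predicates and the same value.\<close>

lemma gauss_curvature_rigid_motion: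
  assumes L: "orthogonal_transformation L"
  shows "gauss_curvature ((\<lambda>x. L x + b) ` \<Sigma>) (L p + b) = gauss_curvature \<Sigma> p"
proof -
  let ?P = "\<lambda>\<Sigma> p k. \<forall>U X q. local_parametrization \<Sigma> U X \<and> q \<in> U \<and> X q = p \<longrightarrow>
               k = parametric_gauss_curvature X q"
  have pull: "?P \<Sigma> p k"
    if "?P ((\<lambda>x. L x + b) ` \<Sigma>) (L p + b) k" "orthogonal_transformation L" for L b \<Sigma> p k
  proof (intro allI impI, elim conjE)
    fix U X q assume X: "local_parametrization \<Sigma> U X" "q \<in> U" "X q = p"
    then have "open U" "smooth_on U X" by (simp_all add: local_parametrization_def)
    from parametric_gauss_curvature_rigid_motion[OF that(2) this X(2), of b]
    show "k = parametric_gauss_curvature X q"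
      using that(1) local_parametrization_rigid_motion[OF that(2) X(1), of b] X(2,3) by metis
  qed
  let ?M = "inv L"
  have M: "orthogonal_transformation ?M" using L by (rule orthogonal_transformation_inv)
  have inv: "?M (L x + b) + - ?M b = x" for x
  proof -
    have "?M (L x + b) = ?M (L x) + ?M b"
      using M by (simp add: orthogonal_transformation linear_add)
    then show ?thesis using orthogonal_transformation_inj[OF L] by simp
  qed
  have "?P ((\<lambda>x. L x + b) ` \<Sigma>) (L p + b) k \<longleftrightarrow> ?P \<Sigma> p k" for k
  proof
    assume "?P \<Sigma> p k"
    then have "?P ((\<lambda>x. ?M x + - ?M b) ` ((\<lambda>x. L x + b) ` \<Sigma>)) (?M (L p + b) + - ?M b) k"
      by (simp only: image_image inv image_ident)
    then show "?P ((\<lambda>x. L x + b) ` \<Sigma>) (L p + b) k"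
      using M by (rule pull)
  qed (rule pull[OF _ L])
  then show ?thesis by (simp add: gauss_curvature_def)
qed


section \<open>Unit normals under rigid motions\<close>

text \<open>Both vectors have to be multiples of \<open>cross3 a b\<close>.\<close>

lemma unit_normal_unique_up_to_sign:
  fixes m n a b :: "real^3"
  assumes "cross3 a b \<noteq> 0"
    and "norm m = 1" "m \<bullet> a = 0" "m \<bullet> b = 0"
    and "norm n = 1" "n \<bullet> a = 0" "n \<bullet> b = 0"
  shows "m = n \<or> m = - n"
proof -
  let ?w = "cross3 a b"
  have "l = sgn ?w \<or> l = - sgn ?w" if "norm l = 1" "l \<bullet> a = 0" "l \<bullet> b = 0" for l
  proof -
    have "cross3 ?w l = 0"
      by (subst cross_skew, subst Lagrange) (simp add: that)
    then obtain k where k: "l = k *\<^sub>R ?w"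
      using that(1) assms(1) by (auto simp: cross_eq_0 collinear_lemma)
    with that(1) have nk: "\<bar>k\<bar> * norm ?w = 1" by simp
    then have "\<bar>k\<bar> = inverse (norm ?w)" using assms(1) by (simp add: field_simps)
    then have "k = inverse (norm ?w) \<or> k = - inverse (norm ?w)" by linarith
    then show ?thesis using k by (auto simp: sgn_div_norm)
  qed
  then show ?thesis using assms(2-) by (metis minus_minus)
qed

lemma cross_partial_derivatives_nonzero:
  assumes "X differentiable (at q)" "inj (frechet_derivative X (at q))"
  shows "cross3 (pd 1 X q) (pd 2 X q) \<noteq> 0"
proof
  let ?D = "frechet_derivative X (at q)"
  let ?e1 = "axis 1 1 :: real^2" and ?e2 = "axis 2 1 :: real^2"
  have lin: "linear ?D" using assms(1) by (rule linear_frechet_derivative)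
  have inj0: "?D w = 0 \<Longrightarrow> w = 0" for w
    using assms(2) lin linear_injective_0 by blast
  assume "cross3 (pd 1 X q) (pd 2 X q) = 0"
  then consider "?D ?e1 = 0" | "?D ?e2 = 0" | c where "?D ?e2 = c *\<^sub>R ?D ?e1"
    by (auto simp: cross_eq_0 collinear_lemma pd_def)
  then show False
  proof cases
    case 3
    then have "?D (?e2 - c *\<^sub>R ?e1) = 0"
      using lin by (simp add: linear_diff linear_cmul)
    from inj0[OF this] have "(?e2 - c *\<^sub>R ?e1) $ 2 = 0" by (metis zero_index)
    then show False by (simp add: axis_def)
  qed (use inj0[of ?e1] inj0[of ?e2] in simp_all)
qed

text \<open>The motion maps the tangent plane at \<open>p\<close> onto a plane of tangent vectors at the image point,
  spanned by the images of the partial derivatives. Both \<open>N (L p + b)\<close> and \<open>L (N p)\<close> are unit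
  normals of that plane.\<close>

lemma unit_normal_field_rigid_motion:
  assumes L: "orthogonal_transformation L" and im: "(\<lambda>x. L x + b) ` \<Sigma> = \<Sigma>"
    and reg: "regular_surface \<Sigma>" and N: "unit_normal_field \<Sigma> N" and p: "p \<in> \<Sigma>"
  shows "N (L p + b) = L (N p) \<or> N (L p + b) = - L (N p)"
proof -
  let ?g = "\<lambda>x. L x + b"
  obtain U X q where X: "local_parametrization \<Sigma> U X" and q: "q \<in> U" "X q = p"
    using reg p by (auto simp: regular_surface_def)
  have gX: "local_parametrization \<Sigma> U (\<lambda>q. L (X q) + b)"
    using local_parametrization_rigid_motion[OF L X, of b] im by simp
  have diff: "X differentiable (at q)" and inj: "inj (frechet_derivative X (at q))"
    using X q smooth_on_imp_differentiable(1) by (auto simp: local_parametrization_def)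
  have inner: "L x \<bullet> L y = x \<bullet> y" for x y
    using L by (simp add: orthogonal_transformation_def)
  have gp: "?g p \<in> \<Sigma>" using im p by blast
  have tan: "pd i X q \<in> tangent_space \<Sigma> p" for i
    using X q unfolding tangent_space_def pd_def by blast
  have "pd i (\<lambda>q. L (X q) + b) q \<in> tangent_space \<Sigma> (?g p)" for i
    using gX q unfolding tangent_space_def pd_def by blast
  then have gtan: "L (pd i X q) \<in> tangent_space \<Sigma> (?g p)" for i
    using pd_affine_comp[OF L diff] by simp
  obtain d where d: "d\<^sup>2 = 1" "\<And>x y. cross3 (L x) (L y) = d *\<^sub>R L (cross3 x y)"
    using cross_orthogonal_transformation_sign[OF L] by blast
  have normL: "norm (L x) = norm x" for x
    using L by (simp add: orthogonal_transformation)
  have "L (cross3 (pd 1 X q) (pd 2 X q)) \<noteq> 0"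
    using cross_partial_derivatives_nonzero[OF diff inj] normL norm_eq_zero by metis
  moreover have "d \<noteq> 0" using d(1) by auto
  ultimately have "cross3 (L (pd 1 X q)) (L (pd 2 X q)) \<noteq> 0"
    by (simp add: d(2))
  then show ?thesis
    using N p gp tan gtan
    by (intro unit_normal_unique_up_to_sign) (auto simp: unit_normal_field_def normL inner)
qed


section \<open>Helicoidal motions\<close>

lemma orthogonal_transformation_rotation_about:
  assumes "norm u = 1"
  shows "orthogonal_transformation (rotation_about u t)"
  unfolding orthogonal_transformation
proof (intro conjI allI)
  show "linear (rotation_about u t)"
    by (rule linearI)
      (simp_all add: rotation_about_def cross_add_right cross_mult_right inner_add_right
        scaleR_add_right scaleR_add_left distrib_left algebra_simps)
  fix x
  have uu: "u \<bullet> u = 1" using assms by (simp add: norm_eq_1)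
  let ?y = "u \<bullet> x" and ?c = "cos t" and ?s = "sin t"
  have cc: "cross3 u x \<bullet> cross3 u x = x \<bullet> x - ?y\<^sup>2"
    by (simp add: dot_cross uu power2_eq_square inner_commute)
  have z: "u \<bullet> cross3 u x = 0" "cross3 u x \<bullet> u = 0" "x \<bullet> cross3 u x = 0" "cross3 u x \<bullet> x = 0"
    by (simp_all add: dot_cross_self inner_commute)
  have "rotation_about u t x \<bullet> rotation_about u t x
      = ?c\<^sup>2 * (x \<bullet> x) + ?s\<^sup>2 * (x \<bullet> x - ?y\<^sup>2) + (1 - ?c)\<^sup>2 * ?y\<^sup>2 + 2 * ?c * (1 - ?c) * ?y\<^sup>2"
    by (simp add: rotation_about_def inner_add_left inner_add_right cc z uu inner_commute[of x u])
      (simp add: power2_eq_square algebra_simps)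
  also have "\<dots> = x \<bullet> x"
    by (simp add: sin_squared_eq) (simp add: power2_eq_square algebra_simps)
  finally show "norm (rotation_about u t x) = norm x" by (simp add: norm_eq_sqrt_inner)
qed

lemma helicoidal_motion_eq_rigid_motion:
  assumes "norm u = 1"
  shows "helicoidal_motion c u h t =
    (\<lambda>x. rotation_about u t x + (c - rotation_about u t c + (h * t) *\<^sub>R u))"
proof -
  have "linear (rotation_about u t)"
    using orthogonal_transformation_rotation_about[OF assms]
    by (simp add: orthogonal_transformation)
  then show ?thesis by (simp add: helicoidal_motion_def linear_diff fun_eq_iff)
qed

lemma inner_axis_helicoidal_motion:
  assumes "norm u = 1"
  shows "u \<bullet> helicoidal_motion c u h t p = u \<bullet> p + h * t"
proof -
  have "u \<bullet> u = 1" using assms by (simp add: norm_eq_1)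
  then show ?thesis
    by (simp add: helicoidal_motion_def rotation_about_def inner_add_right inner_diff_right
        dot_cross_self algebra_simps)
qed

text \<open>Comparing the values at \<open>0, \<pi>\<close> and at \<open>\<plusminus>\<pi>/2\<close> kills the products \<open>a * b\<close>, \<open>a * c\<close> and gives
  \<open>b\<^sup>2 = c\<^sup>2\<close>; if \<open>a = 0\<close>, the values at \<open>\<plusminus>\<pi>/4\<close> also kill \<open>b * c\<close>.\<close>

lemma constant_square_trig:
  fixes a b c k :: real
  assumes "\<And>t. (a + b * cos t + c * sin t)\<^sup>2 = k"
  shows "b = 0" "c = 0"
proof -
  have s: "(cos (pi/4))\<^sup>2 = 1/2" "sin (pi/4) = cos (pi/4)"
    by (simp_all add: cos_45 sin_45 power2_eq_square)
  have "(a + b)\<^sup>2 = k" "(a - b)\<^sup>2 = k" "(a + c)\<^sup>2 = k" "(a - c)\<^sup>2 = k"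
    using assms[of 0] assms[of pi] assms[of "pi/2"] assms[of "-(pi/2)"] by simp_all
  note eqs = this
  have "(a + x)\<^sup>2 - (a - x)\<^sup>2 = 4 * (a * x)" "(a + x)\<^sup>2 + (a - x)\<^sup>2 = 2 * a\<^sup>2 + 2 * x\<^sup>2" for x
    by (simp_all add: power2_eq_square algebra_simps)
  from this[of b] this[of c] eqs
  have ab: "a * b = 0" "a * c = 0" and bc: "b\<^sup>2 = c\<^sup>2"
    by simp_all
  have "b = 0 \<and> c = 0"
  proof (cases "a = 0")
    case True
    have "(cos (pi/4) * (b + c))\<^sup>2 = k" "(cos (pi/4) * (b - c))\<^sup>2 = k"
      using assms[of "pi/4"] assms[of "-(pi/4)"] s(2) True by (simp_all add: algebra_simps)
    then have "(b + c)\<^sup>2 = 2 * k" "(b - c)\<^sup>2 = 2 * k"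
      unfolding power_mult_distrib s(1) by simp_all
    moreover have "(b + c)\<^sup>2 - (b - c)\<^sup>2 = 4 * (b * c)"
      by (simp add: power2_eq_square algebra_simps)
    ultimately have "b * c = 0" by simp
    with bc show ?thesis by auto
  qed (use ab in auto)
  then show "b = 0" "c = 0" by simp_all
qed

text \<open>With \<open>m\<close> the part of \<open>n\<close> orthogonal to \<open>u\<close>, the product \<open>rotation_about u t n \<bullet> v\<close> is a
  trigonometric polynomial in \<open>t\<close> with coefficients \<open>m \<bullet> v\<close> and \<open>cross3 u n \<bullet> v\<close> of
  \<open>cos t\<close> and \<open>sin t\<close>. Both vanish because its square is constant. If \<open>m\<close> were nonzero,
  then \<open>m\<close> and \<open>cross3 u n\<close> would span the plane orthogonal to \<open>u\<close>, and \<open>v\<close> would be parallel to \<open>u\<close>.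

  The hypothesis speaks of the square because a motion transports unit normals only up to a sign
  that a priori depends on \<open>t\<close>.\<close>

lemma normal_parallel_axis_if_constant_rotated_inner:
  fixes u v n :: "real^3"
  assumes u: "norm u = 1" and v: "norm v = 1" and n: "norm n = 1"
    and const: "\<And>t. (rotation_about u t n \<bullet> v)\<^sup>2 = k"
    and npar: "\<nexists>k. u = k *\<^sub>R v"
  shows "n = u \<or> n = - u"
proof -
  let ?m = "n - (u \<bullet> n) *\<^sub>R u"
  have uu: "u \<bullet> u = 1" and vv: "v \<bullet> v = 1" using u v by (simp_all add: norm_eq_1)
  have "((u \<bullet> n) * (u \<bullet> v) + (?m \<bullet> v) * cos t + (cross3 u n \<bullet> v) * sin t)\<^sup>2 = k" for t
    using const[of t]
    by (simp add: rotation_about_def inner_add_left inner_diff_left algebra_simps)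
  from constant_square_trig[OF this] have mv: "?m \<bullet> v = 0" "cross3 u n \<bullet> v = 0" .
  have mu: "?m \<bullet> u = 0" by (simp add: inner_diff_left uu inner_commute[of u n])
  \<comment> \<open>The vector triple product turns the orthogonality of \<open>v\<close> to \<open>?m\<close> and to \<open>cross3 u n\<close> into
    \<open>v\<close> being parallel to \<open>u\<close>, unless \<open>?m \<bullet> n\<close>, the squared length of \<open>?m\<close>, is zero.\<close>
  have "cross3 ?m (cross3 u n) = (?m \<bullet> n) *\<^sub>R u"
    by (simp add: Lagrange mu)
  moreover have "cross3 v (cross3 ?m (cross3 u n)) = 0"
    using mv by (subst Lagrange) (simp add: inner_commute)
  ultimately have "(?m \<bullet> n) *\<^sub>R cross3 v u = 0" by (simp add: cross_mult_right)
  moreover have "cross3 v u \<noteq> 0"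
    using npar u v by (auto simp: cross_eq_0 collinear_lemma)
  ultimately have "?m \<bullet> n = 0" by simp
  then have "(u \<bullet> n)\<^sup>2 = 1"
    using n by (simp add: inner_diff_left norm_eq_1 power2_eq_square)
  moreover have "?m \<bullet> ?m = 1 - (u \<bullet> n)\<^sup>2"
    using n uu by (simp add: inner_diff_left inner_diff_right norm_eq_1 power2_eq_square inner_commute)
  ultimately have "n = (u \<bullet> n) *\<^sub>R u" by simp
  moreover have "u \<bullet> n = 1 \<or> u \<bullet> n = -1" using \<open>(u \<bullet> n)\<^sup>2 = 1\<close> by (simp add: power2_eq_1_iff)
  ultimately show ?thesis by auto
qed

text \<open>If all normals were parallel to the axis, the height \<open>u \<bullet> X\<close> would be constant on a small disc of
  parameters. The image of the disc is relatively open in \<open>\<Sigma>\<close>, so it contains the points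
  obtained by moving \<open>p\<close> for a short time; but the pitch changes the height of these.\<close>

lemma helicoidal_surface_normal_not_parallel_axis:
  assumes hel: "helicoidal_surface c u h \<Sigma>" and N: "unit_normal_field \<Sigma> N" and "p \<in> \<Sigma>"
  shows "\<not> (\<forall>x\<in>\<Sigma>. N x = u \<or> N x = - u)"
proof
  assume par: "\<forall>x\<in>\<Sigma>. N x = u \<or> N x = - u"
  have u: "norm u = 1" and h: "h \<noteq> 0" and reg: "regular_surface \<Sigma>"
    and inv: "\<And>t. helicoidal_motion c u h t ` \<Sigma> = \<Sigma>"
    using hel by (auto simp: helicoidal_surface_def)
  obtain U X q where X: "local_parametrization \<Sigma> U X" and q: "q \<in> U" "X q = p"
    using reg \<open>p \<in> \<Sigma>\<close> by (auto simp: regular_surface_def)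
  then obtain Y where U: "open U" "smooth_on U X" "openin (top_of_set \<Sigma>) (X ` U)"
      "homeomorphism U (X ` U) X Y"
    by (auto simp: local_parametrization_def)
  \<comment> \<open>\<open>U\<close> may be disconnected; on a ball a vanishing derivative forces a constant.\<close>
  obtain e where e: "e > 0" "ball q e \<subseteq> U" using U(1) q(1) openE by blast
  have "((\<lambda>y. u \<bullet> X y) has_derivative (\<lambda>w. 0)) (at y within ball q e)" if "y \<in> ball q e" for y
  proof -
    have y: "y \<in> U" using that e by blast
    then have "(X has_derivative frechet_derivative X (at y)) (at y)"
      using smooth_on_imp_differentiable(1)[OF U(2)] frechet_derivative_works by blast
    then have "((\<lambda>y. u \<bullet> X y) has_derivative (\<lambda>w. u \<bullet> frechet_derivative X (at y) w))
        (at y within ball q e)"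
      by (rule has_derivative_at_withinI[OF has_derivative_inner_right])
    moreover have "u \<bullet> frechet_derivative X (at y) w = 0" for w
    proof -
      have "frechet_derivative X (at y) w \<in> tangent_space \<Sigma> (X y)"
        using X y unfolding tangent_space_def by blast
      moreover have "X y \<in> \<Sigma>" using U(3) y openin_imp_subset by blast
      ultimately have "N (X y) \<bullet> frechet_derivative X (at y) w = 0" "N (X y) = u \<or> N (X y) = - u"
        using N par by (auto simp: unit_normal_field_def)
      then show ?thesis by auto
    qed
    ultimately show ?thesis by simp
  qed
  then obtain k where k: "\<And>y. y \<in> ball q e \<Longrightarrow> u \<bullet> X y = k"
    using has_derivative_zero_constant[OF convex_ball] by metis
  have "openin (top_of_set U) (ball q e)" using e U(1) by (simp add: openin_open_eq)
  from homeomorphism_imp_open_map[OF U(4) this]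
  have "openin (top_of_set \<Sigma>) (X ` ball q e)"
    using U(3) by (rule openin_trans)
  then obtain T where T: "open T" "X ` ball q e = \<Sigma> \<inter> T" by (auto simp: openin_open)
  let ?V = "(\<lambda>t. helicoidal_motion c u h t p) -` T"
  have "continuous_on UNIV (\<lambda>t. helicoidal_motion c u h t p)"
    unfolding helicoidal_motion_def rotation_about_def by (intro continuous_intros)
  then have "open ?V" using T(1) by (simp add: open_vimage)
  moreover have "0 \<in> ?V"
  proof -
    have "p \<in> T" using T(2) q e(1) by (metis IntD2 centre_in_ball imageI)
    then show ?thesis by (simp add: helicoidal_motion_def rotation_about_def)
  qed
  ultimately obtain d where d: "d > 0" "ball 0 d \<subseteq> ?V" using openE by blast
  have "d / 2 \<in> ?V" using d by (intro subsetD[OF d(2)]) simp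
  moreover have "helicoidal_motion c u h (d/2) p \<in> \<Sigma>" using inv \<open>p \<in> \<Sigma>\<close> by blast
  ultimately obtain y where "y \<in> ball q e" "helicoidal_motion c u h (d/2) p = X y"
    using T(2) by (metis IntI imageE vimageE)
  then have "u \<bullet> helicoidal_motion c u h (d/2) p = u \<bullet> p"
    using k q(2) e(1) centre_in_ball by metis
  then show False using h d(1) by (simp add: inner_axis_helicoidal_motion[OF u])
qed

theorem proposition3p1:
  fixes \<alpha> h :: real and v c u :: "real^3"
    and \<Sigma> :: "(real^3) set" and N :: "real^3 \<Rightarrow> real^3"
  assumes "\<alpha> \<noteq> 0"
    and "norm v = 1"
    and "K_translator \<alpha> v \<Sigma> N"
    and "\<not> gauss_curvature \<Sigma> constant_on \<Sigma>"
    and "helicoidal_surface c u h \<Sigma>"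
  shows "\<exists>k. u = k *\<^sub>R v"
proof (rule ccontr)
  assume npar: "\<nexists>k. u = k *\<^sub>R v"
  have u: "norm u = 1" and inv: "\<And>t. helicoidal_motion c u h t ` \<Sigma> = \<Sigma>"
    using assms(5) by (auto simp: helicoidal_surface_def)
  have reg: "regular_surface \<Sigma>" and N: "unit_normal_field \<Sigma> N"
    and K: "\<And>p. p \<in> \<Sigma> \<Longrightarrow> real_power (gauss_curvature \<Sigma> p) \<alpha> = N p \<bullet> v"
    using assms(3) by (auto simp: K_translator_def)
  have "N p = u \<or> N p = - u" if p: "p \<in> \<Sigma>" for p
  proof (rule normal_parallel_axis_if_constant_rotated_inner[OF u assms(2) _ _ npar])
    show "norm (N p) = 1" using N p by (simp add: unit_normal_field_def)
    fix t
    let ?R = "rotation_about u t"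
    define b where "b = c - ?R c + (h * t) *\<^sub>R u"
    have R: "orthogonal_transformation ?R"
      using u by (rule orthogonal_transformation_rotation_about)
    have im: "(\<lambda>x. ?R x + b) ` \<Sigma> = \<Sigma>"
      using inv[of t] by (simp add: helicoidal_motion_eq_rigid_motion[OF u] b_def)
    then have gp: "?R p + b \<in> \<Sigma>" using p by blast
    have "gauss_curvature \<Sigma> (?R p + b) = gauss_curvature \<Sigma> p"
      using gauss_curvature_rigid_motion[OF R, of b \<Sigma> p] im by simp
    then have "N (?R p + b) \<bullet> v = N p \<bullet> v" using K[OF p] K[OF gp] by simp
    then show "(?R (N p) \<bullet> v)\<^sup>2 = (N p \<bullet> v)\<^sup>2"
      using unit_normal_field_rigid_motion[OF R im reg N p]
      by (metis inner_minus_left power2_minus)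
  qed
  moreover obtain p where "p \<in> \<Sigma>"
    using assms(4) by (auto simp: constant_on_def)
  ultimately show False
    using helicoidal_surface_normal_not_parallel_axis[OF assms(5) N] by blast
qed

end
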